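(* Let $f:[x^{\text{left}},x^{\text{right}}]\to\mathbb{R}$ be convex and let $P$ be a finite nonempty $(f,x^{\text{left}},x^{\text{right}})$-convex set of points. Then $$(x^*,f(x^* ))\in\Delta(P)\quad\text{for all}\quad x^*\in\operatorname*{argmin}_{x\in[x^{\text{left}},x^{\text{right}}]}f(x).$$
   Context: A finite nonempty set $P\subset[x^{\text{left}},x^{\text{right}}]\times\mathbb{R}$ is called $(f,x^{\text{left}},x^{\text{right}})$-convex if $y=f(x)$ for all $(x,y)\in P$, and $\operatorname{argmin}_{x\in[x^{\text{left}},x^{\text{right}}]}f(x)\subseteq\big[\min_{(x,y)\in P}x,\ \max_{(x,y)\in P}x\big]$. Write $y^{\text{low}}(P)=\min_{(x,y)\in P}y$. For points $p^i=(x^i,y^i)$ and $p^j=(x^j,y^j)$ with $x^i\ne x^j$, let $f^{ij}$ be the line through them: $f^{ij}(x)=a^{ij}(x-x^i)+y^i$ with $a^{ij}=\frac{y^i-y^j}{x^i-x^j}$. The optimality region of $P$ is $$\Delta(P)=\Big\{(x,y)\in\mathbb{R}^2 :\ x\in\big[\min_{(x',y')\in P}x',\ \max_{(x',y')\in P}x'\big],\ \ y\le y^{\text{low}}(P),\ \ f^{ij}(x)\le y\ \text{ for all } p^i,p^j\in P \text{ with } x^i<x^j \text{ and } x\notin(x^i,x^j)\Big\}.$$ *)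

theory Defs
  imports "HOL-Analysis.Analysis"
begin

definition argmin_on :: "(real \<Rightarrow> real) \<Rightarrow> real set \<Rightarrow> real set" where
  "argmin_on f S = {x. is_arg_min f (\<lambda>z. z \<in> S) x}"

(* f is total here, but only its values on {xl..xr} matter, since fst ` P \<subseteq> {xl..xr}.
   Nonemptiness of P forces xl \<le> xr. *)
definition convex_point_set :: "(real \<Rightarrow> real) \<Rightarrow> real \<Rightarrow> real \<Rightarrow> (real \<times> real) set \<Rightarrow> bool" where
  "convex_point_set f xl xr P \<longleftrightarrow>
     finite P \<and> P \<noteq> {} \<and> P \<subseteq> {xl..xr} \<times> UNIV \<and>
     (\<forall>(x, y)\<in>P. y = f x) \<and>
     argmin_on f {xl..xr} \<subseteq> {Min (fst ` P)..Max (fst ` P)}"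

definition y_low :: "(real \<times> real) set \<Rightarrow> real" where
  "y_low P = Min (snd ` P)"

definition slope :: "real \<times> real \<Rightarrow> real \<times> real \<Rightarrow> real" where
  "slope p q = (snd p - snd q) / (fst p - fst q)"

(* Meaningful only for fst p \<noteq> fst q. *)
definition line_through :: "real \<times> real \<Rightarrow> real \<times> real \<Rightarrow> real \<Rightarrow> real" where
  "line_through p q x = slope p q * (x - fst p) + snd p"

definition optimality_region :: "(real \<times> real) set \<Rightarrow> (real \<times> real) set" where
  "optimality_region P =
     {(x, y). x \<in> {Min (fst ` P)..Max (fst ` P)} \<and> y \<le> y_low P \<and>
        (\<forall>p\<in>P. \<forall>q\<in>P. fst p < fst q \<and> x \<notin> {fst p<..<fst q} \<longrightarrow> line_through p q x \<le> y)}"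

end

theory Submission
  imports Defs
begin

text \<open>Of the three conditions defining the region, the bound on the abscissa is built into
  \<open>convex_point_set\<close>, and \<open>f x \<le> y_low P\<close> holds because the heights in
  \<open>P\<close> are values of \<open>f\<close> on the interval. Only the line condition uses
  convexity: a secant of a convex function lies below its graph outside the open interval between
  the two nodes (\<open>line_through_le_convex\<close>). This holds at every point of the domain,
  minimizer or not.\<close>

text \<open>Convexity with weight \<open>(b - a) / (c - a)\<close> on \<open>c\<close>, cleared of
  denominators. In this form it survives \<open>a = c\<close>, where both sides vanish, and serves
  either side of a secant by permuting the points.\<close>

lemma convex_on_three_points:
  fixes f :: "real \<Rightarrow> real"
  assumes "convex_on S f" "a \<in> S" "c \<in> S" "a \<le> b" "b \<le> c"
  shows "(c - a) * f b \<le> (c - b) * f a + (b - a) * f c"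
proof (cases "a = c")
  case False
  define t where "t = (b - a) / (c - a)"
  have ac: "a < c" using False assms by simp
  have t: "0 \<le> t" "t \<le> 1" "t * (c - a) = b - a"
    using assms ac by (auto simp: t_def)
  have b: "(1 - t) *\<^sub>R a + t *\<^sub>R c = b"
    using t(3) by (simp add: algebra_simps)
  have "f b \<le> (1 - t) * f a + t * f c"
    using convex_onD[OF assms(1) t(1,2) assms(2,3)] unfolding b .
  then have "(c - a) * f b \<le> (c - a) * ((1 - t) * f a + t * f c)"
    using ac by (intro mult_left_mono) auto
  also have "\<dots> = ((c - a) - t * (c - a)) * f a + (t * (c - a)) * f c"
    by (simp add: algebra_simps)
  also have "\<dots> = (c - b) * f a + (b - a) * f c"
    unfolding t(3) by simp
  finally show ?thesis .
qed (use assms in auto)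

text \<open>Outside the open interval, the node nearer to \<open>x\<close> lies between
  \<open>x\<close> and the other node. Convexity bounds \<open>f\<close> at that middle node;
  solving for \<open>f x\<close> gives the secant bound.\<close>

lemma line_through_le_convex:
  assumes "convex_on S f" "a \<in> S" "b \<in> S" "x \<in> S" "a < b" "x \<notin> {a<..<b}"
  shows "line_through (a, f a) (b, f b) x \<le> f x"
proof -
  \<comment> \<open>The goal multiplied by \<open>b - a > 0\<close>, so that it is a linear
    rearrangement of the three-point inequality.\<close>
  have "(f b - f a) * (x - a) + (b - a) * f a \<le> (b - a) * f x"
  proof (cases "x \<le> a")
    case True
    then show ?thesis
      using convex_on_three_points[of S f x b a] assms by (simp add: algebra_simps)
  next
    \<comment> \<open>Now \<open>x \<ge> b\<close>, since \<open>x\<close> avoids the open interval,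
      and \<open>b\<close> is the middle point.\<close>
    case False
    then show ?thesis
      using convex_on_three_points[of S f a x b] assms by (simp add: algebra_simps)
  qed
  moreover have "(b - a) * line_through (a, f a) (b, f b) x
      = (f b - f a) * (x - a) + (b - a) * f a"
    using assms(5) by (simp add: line_through_def slope_def field_simps)
  ultimately show ?thesis
    using assms(5) by (metis diff_gt_0_iff_gt mult_le_cancel_left_pos)
qed

theorem theorem5:
  fixes f :: "real \<Rightarrow> real" and xl xr :: real and P :: "(real \<times> real) set"
  assumes "convex_on {xl..xr} f"
    and "convex_point_set f xl xr P"
  shows "\<forall>x\<in>argmin_on f {xl..xr}. (x, f x) \<in> optimality_region P"
proof
  fix x assume x: "x \<in> argmin_on f {xl..xr}"
  then have xS: "x \<in> {xl..xr}" and fmin: "\<And>z. z \<in> {xl..xr} \<Longrightarrow> f x \<le> f z"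
    by (auto simp: argmin_on_def is_arg_min_linorder)
  have fin: "finite P" "P \<noteq> {}"
    and xP: "x \<in> {Min (fst ` P)..Max (fst ` P)}"
    \<comment> \<open>Writing \<open>p\<close> as a graph point lets the secant lemma, stated for
      pairs \<open>(a, f a)\<close>, apply to members of \<open>P\<close>.\<close>
    and P: "\<And>p. p \<in> P \<Longrightarrow> fst p \<in> {xl..xr} \<and> p = (fst p, f (fst p))"
    using assms(2) x unfolding convex_point_set_def by fastforce+
  have "f x \<le> y_low P"
    unfolding y_low_def using fin fmin P by (auto intro!: Min.boundedI) (metis snd_conv)
  moreover have "line_through p q x \<le> f x"
    if "p \<in> P" "q \<in> P" "fst p < fst q" "x \<notin> {fst p<..<fst q}" for p q
    using line_through_le_convex[OF assms(1) _ _ xS that(3,4)] P that(1,2) by metis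
  ultimately show "(x, f x) \<in> optimality_region P"
    using xP unfolding optimality_region_def by blast
qed

end
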